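(* Let $m,n\ge 2$ and let $f(\mathbf x,\mathbf y)=\sum_{i,j=1}^m\sum_{k,l=1}^n a_{ijkl}x_ix_jy_ky_l$ be an $m\times n$ real biquadratic form which is psd. Suppose $f$ has a nontrivial real zero, i.e. there exist $\mathbf x^*\in\mathbb R^m\setminus\{0\}$ and $\mathbf y^*\in\mathbb R^n\setminus\{0\}$ with $f(\mathbf x^*,\mathbf y^* )=0$. Then there exists an $(m-1)\times(n-1)\times 1$ degenerated tripartite quartic form $h$ such that $f$ is sos if and only if $h$ is sos, and, when they are sos, $f$ and $h$ have the same sos rank.
   Context: All forms have real coefficients and real variables. A form is psd if it takes only nonnegative values on the whole real space. A quartic form is sos if it is a finite sum of squares of real quadratic forms; for an sos form, its sos rank is the minimum number of squares in such an expression. A $p\times q\times 1$ tripartite quartic form is a homogeneous quartic polynomial $h(\mathbf x,\mathbf y,z)$ in variables $\mathbf x=(x_1,\dots,x_p)$, $\mathbf y=(y_1,\dots,y_q)$ and a single variable $z$ such that in every monomial the total degree in the $\mathbf x$-variables is at most $2$ and the total degree in the $\mathbf y$-variables is at most $2$. Writing $h=h_0z^4+h_1(\mathbf x,\mathbf y)z^3+h_2(\mathbf x,\mathbf y)z^2+h_3(\mathbf x,\mathbf y)z+h_4(\mathbf x,\mathbf y)$ with $h_0$ a constant, $h$ is called a degenerated tripartite quartic form if it is psd and $h_0=0$ (the coefficient of $z^4$ vanishes). *)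

theory Defs
  imports Complex_Main "HOL-Library.Poly_Mapping"
begin

text \<open>
  Real polynomials are finitely supported maps from monomials (exponent vectors) to coefficients,
  with the ring structure of \<^theory>\<open>HOL-Library.Poly_Mapping\<close>.
  The variables are \<open>x\<^sub>i\<close>, \<open>y\<^sub>k\<close> and \<open>z\<close>, with indices starting at 1.
\<close>

datatype tvar = VX nat | VY nat | VZ

type_synonym monomial = "tvar \<Rightarrow>\<^sub>0 nat"
type_synonym rpoly = "monomial \<Rightarrow>\<^sub>0 real"

definition pconst :: "real \<Rightarrow> rpoly" where
  "pconst c = Poly_Mapping.single 0 c"

definition pvar :: "tvar \<Rightarrow> rpoly" where
  "pvar v = Poly_Mapping.single (Poly_Mapping.single v 1) 1"

definition poly_eval :: "rpoly \<Rightarrow> (tvar \<Rightarrow> real) \<Rightarrow> real" where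
  "poly_eval p u =
     (\<Sum>t\<in>Poly_Mapping.keys p. Poly_Mapping.lookup p t *
        (\<Prod>v\<in>Poly_Mapping.keys t. u v ^ Poly_Mapping.lookup t v))"

definition point :: "(nat \<Rightarrow> real) \<Rightarrow> (nat \<Rightarrow> real) \<Rightarrow> real \<Rightarrow> tvar \<Rightarrow> real" where
  "point x y z v = (case v of VX i \<Rightarrow> x i | VY k \<Rightarrow> y k | VZ \<Rightarrow> z)"

definition degree_in :: "tvar set \<Rightarrow> monomial \<Rightarrow> nat" where
  "degree_in S t = (\<Sum>v\<in>Poly_Mapping.keys t \<inter> S. Poly_Mapping.lookup t v)"

text \<open>As usual, the zero polynomial counts as a form of every degree.\<close>

definition is_form :: "tvar set \<Rightarrow> nat \<Rightarrow> rpoly \<Rightarrow> bool" where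
  "is_form V d p \<longleftrightarrow>
     (\<forall>t\<in>Poly_Mapping.keys p. Poly_Mapping.keys t \<subseteq> V \<and> degree_in UNIV t = d)"

definition psd :: "rpoly \<Rightarrow> bool" where
  "psd p \<longleftrightarrow> (\<forall>u. poly_eval p u \<ge> 0)"

definition sum_of_squares :: "tvar set \<Rightarrow> nat \<Rightarrow> rpoly \<Rightarrow> bool" where
  "sum_of_squares V r p \<longleftrightarrow>
     (\<exists>q :: nat \<Rightarrow> rpoly. (\<forall>i<r. is_form V 2 (q i)) \<and> p = (\<Sum>i<r. (q i)\<^sup>2))"

definition is_sos :: "tvar set \<Rightarrow> rpoly \<Rightarrow> bool" where
  "is_sos V p \<longleftrightarrow> (\<exists>r. sum_of_squares V r p)"

text \<open>Only meaningful when \<open>is_sos V p\<close>; the zero form has rank 0.\<close>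

definition sos_rank :: "tvar set \<Rightarrow> rpoly \<Rightarrow> nat" where
  "sos_rank V p = (LEAST r. sum_of_squares V r p)"

definition bi_vars :: "nat \<Rightarrow> nat \<Rightarrow> tvar set" where
  "bi_vars m n = VX ` {1..m} \<union> VY ` {1..n}"

definition tri_vars :: "nat \<Rightarrow> nat \<Rightarrow> tvar set" where
  "tri_vars p q = VX ` {1..p} \<union> VY ` {1..q} \<union> {VZ}"

definition biquadratic_form ::
    "nat \<Rightarrow> nat \<Rightarrow> (nat \<Rightarrow> nat \<Rightarrow> nat \<Rightarrow> nat \<Rightarrow> real) \<Rightarrow> rpoly" where
  "biquadratic_form m n a =
     (\<Sum>i=1..m. \<Sum>j=1..m. \<Sum>k=1..n. \<Sum>l=1..n.
        pconst (a i j k l) * pvar (VX i) * pvar (VX j) * pvar (VY k) * pvar (VY l))"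

definition tripartite_quartic :: "nat \<Rightarrow> nat \<Rightarrow> rpoly \<Rightarrow> bool" where
  "tripartite_quartic p q h \<longleftrightarrow> is_form (tri_vars p q) 4 h \<and>
     (\<forall>t\<in>Poly_Mapping.keys h. degree_in (range VX) t \<le> 2 \<and> degree_in (range VY) t \<le> 2)"

definition degenerated_tripartite_quartic :: "nat \<Rightarrow> nat \<Rightarrow> rpoly \<Rightarrow> bool" where
  "degenerated_tripartite_quartic p q h \<longleftrightarrow> tripartite_quartic p q h \<and> psd h \<and>
     Poly_Mapping.lookup h (Poly_Mapping.single VZ 4) = 0"

end

theory Submission
  imports Defs
begin

text \<open>
  After linear changes of \<open>x\<close> and \<open>y\<close> the zero sits at \<open>(e\<^sub>m, e\<^sub>n)\<close>, so \<open>x\<^sub>m\<^sup>2 y\<^sub>n\<^sup>2\<close> has coefficient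
  0, and \<open>h\<close> arises from \<open>f\<close> by setting \<open>x\<^sub>m = y\<^sub>n = z\<close>. Substitution turns a decomposition of \<open>f\<close>
  into \<open>r\<close> squares into one of \<open>h\<close>. Conversely, if \<open>h\<close> is a sum of \<open>r\<close> squares \<open>q\<^sub>i\<^sup>2\<close>, then setting all
  variables but the \<open>x\<close> (or the \<open>y\<close>, or \<open>z\<close>) to 0 annihilates \<open>h\<close>, hence every \<open>q\<^sub>i\<close>; so
  \<open>q\<^sub>i = B\<^sub>i(x, y) + z a\<^sub>i(x) + z b\<^sub>i(y)\<close> with \<open>B\<^sub>i\<close> bilinear and \<open>a\<^sub>i\<close>, \<open>b\<^sub>i\<close> linear. This can be bihomogenised
  to \<open>B\<^sub>i(x, y) + y\<^sub>n a\<^sub>i(x) + x\<^sub>m b\<^sub>i(y)\<close>, and the squares of these forms sum to \<open>f\<close>. Hence \<open>f\<close> and \<open>h\<close>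
  are sums of \<open>r\<close> squares for the same numbers \<open>r\<close>.
\<close>

subsection \<open>Evaluation of monomials and polynomials\<close>

text \<open>The target is any commutative monoid so that the same product serves for real points
  and, in \<open>poly_subst\<close>, for polynomials put in place of variables.\<close>

definition monom_eval :: "monomial \<Rightarrow> (tvar \<Rightarrow> 'a::comm_monoid_mult) \<Rightarrow> 'a" where
  "monom_eval t u = (\<Prod>v\<in>Poly_Mapping.keys t. u v ^ Poly_Mapping.lookup t v)"

lemma keys_plus_nat:
  fixes s t :: "'a \<Rightarrow>\<^sub>0 nat"
  shows "Poly_Mapping.keys (s + t) = Poly_Mapping.keys s \<union> Poly_Mapping.keys t"
  by (auto simp: in_keys_iff lookup_add)

lemma monom_eval_superset:
  assumes "finite A" "Poly_Mapping.keys t \<subseteq> A"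
  shows "monom_eval t u = (\<Prod>v\<in>A. u v ^ Poly_Mapping.lookup t v)"
  unfolding monom_eval_def
  by (rule prod.mono_neutral_left) (use assms in \<open>auto simp: in_keys_iff\<close>)

lemma monom_eval_plus: "monom_eval (s + t) u = monom_eval s u * monom_eval t u"
proof -
  let ?A = "Poly_Mapping.keys s \<union> Poly_Mapping.keys t"
  have "monom_eval (s + t) u = (\<Prod>v\<in>?A. u v ^ Poly_Mapping.lookup (s + t) v)"
    by (rule monom_eval_superset) (auto simp: keys_plus_nat)
  also have "\<dots> = (\<Prod>v\<in>?A. u v ^ Poly_Mapping.lookup s v) * (\<Prod>v\<in>?A. u v ^ Poly_Mapping.lookup t v)"
    by (simp add: lookup_add power_add prod.distrib)
  also have "(\<Prod>v\<in>?A. u v ^ Poly_Mapping.lookup s v) = monom_eval s u"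
    by (rule monom_eval_superset [symmetric]) auto
  also have "(\<Prod>v\<in>?A. u v ^ Poly_Mapping.lookup t v) = monom_eval t u"
    by (rule monom_eval_superset [symmetric]) auto
  finally show ?thesis .
qed

lemma monom_eval_mult: "monom_eval t (\<lambda>v. u v * w v) = monom_eval t u * monom_eval t w"
  by (simp add: monom_eval_def power_mult_distrib prod.distrib)

lemma monom_eval_zero [simp]: "monom_eval 0 u = 1"
  by (simp add: monom_eval_def)

lemma monom_eval_single [simp]: "monom_eval (Poly_Mapping.single v k) u = u v ^ k"
  by (cases "k = 0") (simp_all add: monom_eval_def)

lemma poly_eval_monom_eval:
  "poly_eval p u = (\<Sum>t\<in>Poly_Mapping.keys p. Poly_Mapping.lookup p t * monom_eval t u)"
  by (simp add: poly_eval_def monom_eval_def)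

lemma poly_eval_zero [simp]: "poly_eval 0 u = 0"
  by (simp add: poly_eval_def)

lemma poly_eval_add [simp]: "poly_eval (p + q) u = poly_eval p u + poly_eval q u"
  unfolding poly_eval_monom_eval
  by (rule setsum_keys_plus_distrib) (simp_all add: distrib_right)

lemma poly_eval_sum [simp]: "poly_eval (sum p A) u = (\<Sum>i\<in>A. poly_eval (p i) u)"
  by (induction A rule: infinite_finite_induct) simp_all

lemma poly_eval_single: "poly_eval (Poly_Mapping.single t c) u = c * monom_eval t u"
  by (cases "c = 0") (simp_all add: poly_eval_monom_eval)

lemma sum_single_keys: "(\<Sum>t\<in>Poly_Mapping.keys p. Poly_Mapping.single t (Poly_Mapping.lookup p t)) = p"
  by (rule poly_mapping_eqI)
    (auto simp: lookup_sum lookup_single when_def in_keys_iff)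

lemma poly_eval_mult [simp]: "poly_eval (p * q) u = poly_eval p u * poly_eval q u"
proof -
  have "p * q = (\<Sum>s\<in>Poly_Mapping.keys p. \<Sum>t\<in>Poly_Mapping.keys q. Poly_Mapping.single (s + t) (Poly_Mapping.lookup p s * Poly_Mapping.lookup q t))"
    by (subst (1) sum_single_keys [of p, symmetric], subst (1) sum_single_keys [of q, symmetric])
      (simp add: sum_product mult_single)
  then have "poly_eval (p * q) u =
      (\<Sum>s\<in>Poly_Mapping.keys p. \<Sum>t\<in>Poly_Mapping.keys q. (Poly_Mapping.lookup p s * monom_eval s u) * (Poly_Mapping.lookup q t * monom_eval t u))"
    by (simp add: poly_eval_single monom_eval_plus mult_ac)
  also have "\<dots> = poly_eval p u * poly_eval q u"
    by (simp add: poly_eval_monom_eval sum_product)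
  finally show ?thesis .
qed

lemma poly_eval_const [simp]: "poly_eval (pconst c) u = c"
  by (simp add: pconst_def poly_eval_single)

lemma poly_eval_var [simp]: "poly_eval (pvar v) u = u v"
  by (simp add: pvar_def poly_eval_single)

lemma poly_eval_one [simp]: "poly_eval 1 u = 1"
  using poly_eval_const [of 1 u] by (simp add: pconst_def)

lemma poly_eval_power [simp]: "poly_eval (p ^ k) u = poly_eval p u ^ k"
  by (induction k) simp_all

lemma poly_eval_prod [simp]: "poly_eval (prod p A) u = (\<Prod>i\<in>A. poly_eval (p i) u)"
  by (induction A rule: infinite_finite_induct) simp_all

lemma poly_eval_uminus [simp]: "poly_eval (- p) u = - poly_eval p u"
  using poly_eval_add [of p "- p" u] by (simp del: poly_eval_add)

lemma poly_eval_diff [simp]: "poly_eval (p - q) u = poly_eval p u - poly_eval q u"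
  using poly_eval_add [of p "- q" u] by (simp del: poly_eval_add)

section \<open>Separation of polynomials by their values\<close>

lemma monom_eval_real_eq_imp_eq:
  assumes "\<And>u :: tvar \<Rightarrow> real. (\<forall>v. u v \<noteq> 0) \<Longrightarrow> monom_eval s u = monom_eval t u"
  shows "s = t"
proof (rule poly_mapping_eqI)
  fix v
  \<comment> \<open>At this point a monomial takes the value 2 to the exponent of \<open>v\<close>,
    the other variables contributing 1.\<close>
  let ?u = "\<lambda>w :: tvar. if w = v then 2 else 1 :: real"
  have eval: "monom_eval r ?u = 2 ^ Poly_Mapping.lookup r v" for r
    by (subst monom_eval_superset [of "insert v (Poly_Mapping.keys r)"])
      (auto simp: prod.insert_remove)
  have "(2::real) ^ Poly_Mapping.lookup s v = 2 ^ Poly_Mapping.lookup t v"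
    using assms [of ?u] by (simp only: eval) simp
  then show "Poly_Mapping.lookup s v = Poly_Mapping.lookup t v"
    by simp
qed

text \<open>Dedekind's argument for the independence of characters, applied to the group of nowhere
  vanishing points.\<close>

lemma monom_eval_independent:
  assumes "finite K"
    and "\<And>u :: tvar \<Rightarrow> real. (\<forall>v. u v \<noteq> 0) \<Longrightarrow> (\<Sum>t\<in>K. c t * monom_eval t u) = 0"
    and "t \<in> K"
  shows "c t = 0"
  using assms
proof (induction K arbitrary: c t rule: finite_induct)
  case empty
  then show ?case by simp
next
  case (insert s K)
  have zero: "c r = 0" if "r \<in> K" for r
  proof -
    have "r \<noteq> s"
      using that insert.hyps by blast
    then obtain w :: "tvar \<Rightarrow> real"
      where w: "\<forall>v. w v \<noteq> 0" "monom_eval r w \<noteq> monom_eval s w"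
      using monom_eval_real_eq_imp_eq by blast
    have "(\<Sum>t\<in>K. (c t * (monom_eval t w - monom_eval s w)) * monom_eval t u) = 0"
      if u: "\<forall>v. u v \<noteq> 0" for u :: "tvar \<Rightarrow> real"
    proof -
      have "(\<Sum>t\<in>insert s K. c t * monom_eval t (\<lambda>v. w v * u v)) = 0"
        by (rule insert.prems(1)) (use u w in simp)
      moreover have "(\<Sum>t\<in>insert s K. c t * monom_eval t u) = 0"
        by (rule insert.prems(1)) (use u in simp)
      \<comment> \<open>Translating the relation by \<open>w\<close> and subtracting
        \<open>monom_eval s w\<close> times the original one removes the term of
        \<open>s\<close>.\<close>
      ultimately have "(\<Sum>t\<in>insert s K. c t * monom_eval t (\<lambda>v. w v * u v))
          - monom_eval s w * (\<Sum>t\<in>insert s K. c t * monom_eval t u) = 0"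
        by simp
      then show ?thesis
        using insert.hyps
        by (simp add: monom_eval_mult algebra_simps sum_distrib_left sum_subtractf)
    qed
    then have "c r * (monom_eval r w - monom_eval s w) = 0"
      using insert.IH [of "\<lambda>t. c t * (monom_eval t w - monom_eval s w)" r] that by blast
    then show ?thesis
      using w by simp
  qed
  have "(\<Sum>t\<in>insert s K. c t * monom_eval t (\<lambda>_. 1)) = 0"
    by (rule insert.prems(1)) simp
  then have "c s = 0"
    using insert.hyps zero by (simp add: monom_eval_def)
  then show ?case
    using zero insert.prems(2) by blast
qed

text \<open>Testing only nowhere vanishing points leaves later identities free to divide by
  coordinates.\<close>

lemma poly_eqI:
  assumes "\<And>u. (\<forall>v. u v \<noteq> 0) \<Longrightarrow> poly_eval p u = poly_eval q u"
  shows "p = q"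
proof -
  have "Poly_Mapping.lookup (p - q) t = 0" if "t \<in> Poly_Mapping.keys (p - q)" for t
  proof (rule monom_eval_independent [OF finite_keys _ that])
    fix u :: "tvar \<Rightarrow> real"
    assume "\<forall>v. u v \<noteq> 0"
    then show "(\<Sum>t\<in>Poly_Mapping.keys (p - q). Poly_Mapping.lookup (p - q) t * monom_eval t u) = 0"
      using assms [of u] by (simp flip: poly_eval_monom_eval)
  qed
  then have "p - q = 0"
    by (intro poly_mapping_eqI) (auto simp: in_keys_iff)
  then show ?thesis
    by simp
qed

section \<open>Restriction to coordinate subspaces\<close>

lemma monom_eval_restrict:
  fixes u :: "tvar \<Rightarrow> real"
  shows "monom_eval t (\<lambda>v. if v \<in> S then u v else 0) =
    (if Poly_Mapping.keys t \<subseteq> S then monom_eval t u else 0)"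
  by (auto simp: monom_eval_def in_keys_iff intro!: prod.cong)

text \<open>Monomials with a variable outside \<open>S\<close> vanish at the restricted points; the
  remaining ones are linearly independent, so they cannot cancel.\<close>

lemma poly_eval_restrict_eq_0_iff:
  "(\<forall>u. poly_eval p (\<lambda>v. if v \<in> S then u v else 0) = 0) \<longleftrightarrow> (\<forall>t\<in>Poly_Mapping.keys p. \<not> Poly_Mapping.keys t \<subseteq> S)"
proof
  assume zero: "\<forall>u. poly_eval p (\<lambda>v. if v \<in> S then u v else 0) = 0"
  show "\<forall>t\<in>Poly_Mapping.keys p. \<not> Poly_Mapping.keys t \<subseteq> S"
  proof
    fix t
    assume t: "t \<in> Poly_Mapping.keys p"
    have "(if Poly_Mapping.keys t \<subseteq> S then Poly_Mapping.lookup p t else 0) = 0"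
    proof (rule monom_eval_independent [OF finite_keys _ t])
      fix u :: "tvar \<Rightarrow> real"
      have "(\<Sum>t\<in>Poly_Mapping.keys p. (if Poly_Mapping.keys t \<subseteq> S then Poly_Mapping.lookup p t else 0) * monom_eval t u) =
          poly_eval p (\<lambda>v. if v \<in> S then u v else 0)"
        unfolding poly_eval_monom_eval monom_eval_restrict by (rule sum.cong) auto
      then show "(\<Sum>t\<in>Poly_Mapping.keys p. (if Poly_Mapping.keys t \<subseteq> S then Poly_Mapping.lookup p t else 0) * monom_eval t u) = 0"
        using zero by simp
    qed
    then show "\<not> Poly_Mapping.keys t \<subseteq> S"
      using t by (auto simp: in_keys_iff)
  qed
next
  assume "\<forall>t\<in>Poly_Mapping.keys p. \<not> Poly_Mapping.keys t \<subseteq> S"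
  then show "\<forall>u. poly_eval p (\<lambda>v. if v \<in> S then u v else 0) = 0"
    by (auto simp: poly_eval_monom_eval monom_eval_restrict intro!: sum.neutral)
qed

subsection \<open>Degrees and forms\<close>

lemma degree_in_superset:
  assumes "finite A" "Poly_Mapping.keys t \<subseteq> A"
  shows "degree_in S t = (\<Sum>v\<in>A \<inter> S. Poly_Mapping.lookup t v)"
  unfolding degree_in_def
  by (rule sum.mono_neutral_left) (use assms in \<open>auto simp: in_keys_iff\<close>)

lemma degree_in_plus: "degree_in S (s + t) = degree_in S s + degree_in S t"
proof -
  let ?A = "Poly_Mapping.keys s \<union> Poly_Mapping.keys t"
  have "degree_in S (s + t) = (\<Sum>v\<in>?A \<inter> S. Poly_Mapping.lookup (s + t) v)"
    by (rule degree_in_superset) (auto simp: keys_plus_nat)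
  also have "\<dots> = (\<Sum>v\<in>?A \<inter> S. Poly_Mapping.lookup s v) + (\<Sum>v\<in>?A \<inter> S. Poly_Mapping.lookup t v)"
    by (simp add: lookup_add sum.distrib)
  also have "(\<Sum>v\<in>?A \<inter> S. Poly_Mapping.lookup s v) = degree_in S s"
    by (rule degree_in_superset [symmetric]) auto
  also have "(\<Sum>v\<in>?A \<inter> S. Poly_Mapping.lookup t v) = degree_in S t"
    by (rule degree_in_superset [symmetric]) auto
  finally show ?thesis .
qed

lemma degree_in_zero [simp]: "degree_in S 0 = 0"
  by (simp add: degree_in_def)

lemma degree_in_single: "degree_in S (Poly_Mapping.single v k) = (if v \<in> S then k else 0)"
  by (cases "k = 0") (auto simp: degree_in_def)

lemma degree_in_eq_0_iff: "degree_in S t = 0 \<longleftrightarrow> Poly_Mapping.keys t \<inter> S = {}"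
  by (auto simp: degree_in_def in_keys_iff)

lemma degree_in_Un:
  "S \<inter> T = {} \<Longrightarrow> degree_in (S \<union> T) t = degree_in S t + degree_in T t"
  unfolding degree_in_def by (subst Int_Un_distrib, rule sum.union_disjoint) auto

lemma degree_in_UNIV: "Poly_Mapping.keys t \<subseteq> S \<Longrightarrow> degree_in UNIV t = degree_in S t"
  unfolding degree_in_def by (rule sum.cong) auto

lemma range_tvar: "range VX \<union> range VY \<union> {VZ} = UNIV"
proof -
  have "v \<in> range VX \<union> range VY \<union> {VZ}" for v
    by (cases v) auto
  then show ?thesis
    by blast
qed

lemma degree_in_UNIV_split:
  "degree_in UNIV t = degree_in (range VX) t + degree_in (range VY) t + degree_in {VZ} t"
proof -
  have "degree_in (range VX \<union> range VY \<union> {VZ}) t =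
      degree_in (range VX) t + degree_in (range VY) t + degree_in {VZ} t"
    by (subst degree_in_Un, blast, subst degree_in_Un) auto
  then show ?thesis
    by (simp only: range_tvar)
qed

lemma keys_subset_of_degree_in_0:
  assumes "S \<union> T \<union> U = UNIV" "degree_in S t = 0" "degree_in T t = 0"
  shows "Poly_Mapping.keys t \<subseteq> U"
proof
  fix v
  assume "v \<in> Poly_Mapping.keys t"
  moreover have "v \<in> S \<union> T \<union> U"
    by (simp only: assms(1) UNIV_I)
  ultimately show "v \<in> U"
    using assms(2,3) unfolding degree_in_eq_0_iff by (auto simp only: Un_iff Int_iff disjoint_iff)
qed

lemma is_form_zero [simp]: "is_form V d 0"
  by (simp add: is_form_def)

lemma is_form_add: "is_form V d p \<Longrightarrow> is_form V d q \<Longrightarrow> is_form V d (p + q)"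
  unfolding is_form_def using keys_add [of p q] by blast

lemma is_form_uminus: "is_form V d p \<Longrightarrow> is_form V d (- p)"
  unfolding is_form_def by simp

lemma is_form_diff: "is_form V d p \<Longrightarrow> is_form V d q \<Longrightarrow> is_form V d (p - q)"
  using is_form_add [of V d p "- q"] is_form_uminus by simp

lemma is_form_sum: "(\<And>i. i \<in> A \<Longrightarrow> is_form V d (p i)) \<Longrightarrow> is_form V d (sum p A)"
  by (induction A rule: infinite_finite_induct) (simp_all add: is_form_add)

lemma is_form_mult:
  assumes "is_form V c p" "is_form V d q"
  shows "is_form V (c + d) (p * q)"
  unfolding is_form_def
proof
  fix t
  assume "t \<in> Poly_Mapping.keys (p * q)"
  then obtain r s where "t = r + s" "r \<in> Poly_Mapping.keys p" "s \<in> Poly_Mapping.keys q"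
    using keys_mult [of p q] by blast
  then show "Poly_Mapping.keys t \<subseteq> V \<and> degree_in UNIV t = c + d"
    using assms by (auto simp: is_form_def keys_plus_nat degree_in_plus)
qed

lemma is_form_const: "is_form V 0 (pconst c)"
  by (cases "c = 0") (simp_all add: is_form_def pconst_def)

lemma is_form_scale: "is_form V d p \<Longrightarrow> is_form V d (pconst c * p)"
  using is_form_mult [OF is_form_const] by fastforce

lemma is_form_var: "v \<in> V \<Longrightarrow> is_form V 1 (pvar v)"
  by (simp add: is_form_def pvar_def degree_in_single)

lemma is_form_power: "is_form V d p \<Longrightarrow> is_form V (k * d) (p ^ k)"
proof (induction k)
  case 0
  then show ?case
    using is_form_const [of V 1] by (simp add: pconst_def)
next
  case (Suc k)
  then show ?case
    using is_form_mult [of V d p "k * d" "p ^ k"] by simp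
qed

lemma is_form_prod:
  "finite A \<Longrightarrow> (\<And>i. i \<in> A \<Longrightarrow> is_form V (d i) (p i)) \<Longrightarrow> is_form V (sum d A) (prod p A)"
proof (induction A rule: finite_induct)
  case empty
  then show ?case
    using is_form_const [of V 1] by (simp add: pconst_def)
next
  case (insert i A)
  then show ?case
    by (simp add: is_form_mult)
qed

text \<open>A bound instead of an exact degree: the linear forms substituted later mix a block with
  \<open>VZ\<close>, so their products need not be homogeneous in that block.\<close>

definition deg_bounded :: "tvar set \<Rightarrow> nat \<Rightarrow> rpoly \<Rightarrow> bool" where
  "deg_bounded S d p \<longleftrightarrow> (\<forall>t\<in>Poly_Mapping.keys p. degree_in S t \<le> d)"

lemma deg_bounded_zero [simp]: "deg_bounded S d 0"
  by (simp add: deg_bounded_def)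

lemma deg_bounded_add:
  "deg_bounded S d p \<Longrightarrow> deg_bounded S d q \<Longrightarrow> deg_bounded S d (p + q)"
  unfolding deg_bounded_def using keys_add [of p q] by blast

lemma deg_bounded_sum: "(\<And>i. i \<in> A \<Longrightarrow> deg_bounded S d (p i)) \<Longrightarrow> deg_bounded S d (sum p A)"
  by (induction A rule: infinite_finite_induct) (simp_all add: deg_bounded_add)

lemma deg_bounded_mult:
  assumes "deg_bounded S c p" "deg_bounded S d q"
  shows "deg_bounded S (c + d) (p * q)"
  unfolding deg_bounded_def
proof
  fix t
  assume "t \<in> Poly_Mapping.keys (p * q)"
  then obtain r s where "t = r + s" "r \<in> Poly_Mapping.keys p" "s \<in> Poly_Mapping.keys q"
    using keys_mult [of p q] by blast
  then show "degree_in S t \<le> c + d"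
    using assms by (auto simp: deg_bounded_def degree_in_plus intro: add_mono)
qed

lemma deg_bounded_const: "deg_bounded S 0 (pconst c)"
  by (cases "c = 0") (simp_all add: deg_bounded_def pconst_def)

lemma deg_bounded_var: "deg_bounded S (if v \<in> S then 1 else 0) (pvar v)"
  by (simp add: deg_bounded_def pvar_def degree_in_single)

subsection \<open>Substitution\<close>

definition poly_subst :: "rpoly \<Rightarrow> (tvar \<Rightarrow> rpoly) \<Rightarrow> rpoly" where
  "poly_subst p L = (\<Sum>t\<in>Poly_Mapping.keys p. pconst (Poly_Mapping.lookup p t) * monom_eval t L)"

lemma poly_eval_subst [simp]:
  "poly_eval (poly_subst p L) u = poly_eval p (\<lambda>v. poly_eval (L v) u)"
  by (simp add: poly_subst_def poly_eval_monom_eval [of p] monom_eval_def)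

text \<open>Since 0 counts as a linear form, variables may also be sent to 0.\<close>

lemma is_form_subst:
  assumes p: "is_form W d p" and L: "\<And>v. v \<in> W \<Longrightarrow> is_form V 1 (L v)"
  shows "is_form V d (poly_subst p L)"
  unfolding poly_subst_def
proof (intro is_form_sum is_form_scale)
  fix t
  assume t: "t \<in> Poly_Mapping.keys p"
  have "is_form V (\<Sum>v\<in>Poly_Mapping.keys t. Poly_Mapping.lookup t v * 1) (monom_eval t L)"
    unfolding monom_eval_def
    using p t by (intro is_form_prod is_form_power L) (auto simp: is_form_def)
  moreover have "(\<Sum>v\<in>Poly_Mapping.keys t. Poly_Mapping.lookup t v * 1) = d"
    using p t by (simp add: is_form_def degree_in_def)
  ultimately show "is_form V d (monom_eval t L)"
    by simp
qed

text \<open>Multiplicativity of \<open>monom_eval t\<close> splits off the scaling factors. They may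
  be 0, which switches a block off, with \<open>0 ^ 0 = 1\<close>.\<close>

lemma monom_eval_scale:
  fixes u :: "tvar \<Rightarrow> real"
  shows "monom_eval t (case_tvar (\<lambda>i. \<alpha> * u (VX i)) (\<lambda>k. \<beta> * u (VY k)) (\<gamma> * u VZ)) =
    \<alpha> ^ degree_in (range VX) t * \<beta> ^ degree_in (range VY) t * \<gamma> ^ degree_in {VZ} t * monom_eval t u"
proof -
  let ?c = "case_tvar (\<lambda>_. \<alpha>) (\<lambda>_. \<beta>) \<gamma>"
  let ?g = "\<lambda>v. ?c v ^ Poly_Mapping.lookup t v"
  have split: "Poly_Mapping.keys t = (Poly_Mapping.keys t \<inter> range VX) \<union> (Poly_Mapping.keys t \<inter> range VY) \<union> (Poly_Mapping.keys t \<inter> {VZ})"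
    using range_tvar by blast
  have "monom_eval t ?c = prod ?g ((Poly_Mapping.keys t \<inter> range VX) \<union> (Poly_Mapping.keys t \<inter> range VY) \<union> (Poly_Mapping.keys t \<inter> {VZ}))"
    unfolding monom_eval_def by (subst split) (rule refl)
  also have "\<dots> = prod ?g (Poly_Mapping.keys t \<inter> range VX) * prod ?g (Poly_Mapping.keys t \<inter> range VY) * prod ?g (Poly_Mapping.keys t \<inter> {VZ})"
    by (subst prod.union_disjoint, simp, simp, blast, subst prod.union_disjoint) auto
  also have "prod ?g (Poly_Mapping.keys t \<inter> range VX) = \<alpha> ^ degree_in (range VX) t"
    unfolding degree_in_def power_sum by (rule prod.cong) auto
  also have "prod ?g (Poly_Mapping.keys t \<inter> range VY) = \<beta> ^ degree_in (range VY) t"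
    unfolding degree_in_def power_sum by (rule prod.cong) auto
  also have "prod ?g (Poly_Mapping.keys t \<inter> {VZ}) = \<gamma> ^ degree_in {VZ} t"
    unfolding degree_in_def power_sum by (rule prod.cong) auto
  finally have c: "monom_eval t ?c = \<alpha> ^ degree_in (range VX) t * \<beta> ^ degree_in (range VY) t * \<gamma> ^ degree_in {VZ} t" .
  have "case_tvar (\<lambda>i. \<alpha> * u (VX i)) (\<lambda>k. \<beta> * u (VY k)) (\<gamma> * u VZ) = (\<lambda>v. ?c v * u v)"
    by (auto simp: fun_eq_iff split: tvar.split)
  then show ?thesis
    by (simp only: monom_eval_mult c)
qed

subsection \<open>Quadratic forms occurring in sums of squares\<close>

text \<open>At points supported on \<open>S\<close> the sum of squares vanishes, and real squares
  cannot cancel.\<close>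

lemma sum_of_squares_keys:
  fixes q :: "nat \<Rightarrow> rpoly"
  assumes "\<forall>t\<in>Poly_Mapping.keys (\<Sum>i<r. (q i)\<^sup>2). \<not> Poly_Mapping.keys t \<subseteq> S" and "i < r"
  shows "\<forall>t\<in>Poly_Mapping.keys (q i). \<not> Poly_Mapping.keys t \<subseteq> S"
  unfolding poly_eval_restrict_eq_0_iff [symmetric]
proof
  fix u
  let ?u = "\<lambda>v. if v \<in> S then u v else 0 :: real"
  have "(\<Sum>i<r. (poly_eval (q i) ?u)\<^sup>2) = 0"
    using assms(1) [unfolded poly_eval_restrict_eq_0_iff [symmetric]] by simp
  then have "\<forall>i\<in>{..<r}. (poly_eval (q i) ?u)\<^sup>2 = 0"
    by (subst (asm) sum_nonneg_eq_0_iff) auto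
  then show "poly_eval (q i) ?u = 0"
    using assms(2) by simp
qed

text \<open>By the hypotheses on the monomials, \<open>q = B(x, y) + z a(x) + z b(y)\<close>, and both sides equal
  the bilinear form \<open>B(x, y) + \<eta> a(x) + \<xi> b(y)\<close>.\<close>

lemma poly_eval_bihomogenize:
  assumes form: "is_form V 2 q"
    and no_X: "\<forall>t\<in>Poly_Mapping.keys q. \<not> Poly_Mapping.keys t \<subseteq> range VX"
    and no_Y: "\<forall>t\<in>Poly_Mapping.keys q. \<not> Poly_Mapping.keys t \<subseteq> range VY"
    and no_Z: "\<forall>t\<in>Poly_Mapping.keys q. \<not> Poly_Mapping.keys t \<subseteq> {VZ}"
    and nz: "\<xi> \<noteq> 0" "\<eta> \<noteq> 0"
  shows "poly_eval q (case_tvar x y 0) + poly_eval q (case_tvar x (\<lambda>_. 0) \<eta>) +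
      poly_eval q (case_tvar (\<lambda>_. 0) y \<xi>) =
    \<xi> * \<eta> * poly_eval q (case_tvar (\<lambda>i. x i / \<xi>) (\<lambda>k. y k / \<eta>) 1)"
proof -
  let ?m = "\<lambda>t. monom_eval t (case_tvar x y 1)"
  have eval: "monom_eval t (case_tvar (\<lambda>i. \<alpha> * x i) (\<lambda>k. \<beta> * y k) \<gamma>) =
      \<alpha> ^ degree_in (range VX) t * \<beta> ^ degree_in (range VY) t * \<gamma> ^ degree_in {VZ} t * ?m t"
    for t \<alpha> \<beta> \<gamma>
    using monom_eval_scale [of t \<alpha> "case_tvar x y 1" \<beta> \<gamma>] by simp
  have "monom_eval t (case_tvar x y 0) + monom_eval t (case_tvar x (\<lambda>_. 0) \<eta>) +
        monom_eval t (case_tvar (\<lambda>_. 0) y \<xi>) =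
      \<xi> * \<eta> * monom_eval t (case_tvar (\<lambda>i. x i / \<xi>) (\<lambda>k. y k / \<eta>) 1)"
    if t: "t \<in> Poly_Mapping.keys q" for t
  proof -
    let ?a = "degree_in (range VX) t"
    let ?b = "degree_in (range VY) t"
    let ?c = "degree_in {VZ} t"
    have "?a + ?b + ?c = 2"
      using form t degree_in_UNIV_split [of t] by (simp add: is_form_def)
    moreover have "\<not> Poly_Mapping.keys t \<subseteq> range VX" "\<not> Poly_Mapping.keys t \<subseteq> range VY" "\<not> Poly_Mapping.keys t \<subseteq> {VZ}"
      using no_X no_Y no_Z t by simp_all
    then have "?a \<noteq> 0 \<or> ?b \<noteq> 0" "?b \<noteq> 0 \<or> ?c \<noteq> 0" "?a \<noteq> 0 \<or> ?c \<noteq> 0"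
      using keys_subset_of_degree_in_0 [of "range VX" "range VY" "{VZ}" t]
        keys_subset_of_degree_in_0 [of "range VY" "{VZ}" "range VX" t]
        keys_subset_of_degree_in_0 [of "range VX" "{VZ}" "range VY" t] range_tvar
      by (auto simp only: Un_ac)
    \<comment> \<open>At least two of the blocks occur and the total degree is 2, so exactly two
      occur, each once.\<close>
    moreover have "i = 1 \<and> j = 1 \<and> k = 0 \<or> i = 1 \<and> j = 0 \<and> k = 1 \<or> i = 0 \<and> j = 1 \<and> k = 1"
      if "i + j + k = 2" "i \<noteq> 0 \<or> j \<noteq> 0" "j \<noteq> 0 \<or> k \<noteq> 0" "i \<noteq> 0 \<or> k \<noteq> 0" for i j k :: nat
      using that by presburger
    ultimately have "?a = 1 \<and> ?b = 1 \<and> ?c = 0 \<or> ?a = 1 \<and> ?b = 0 \<and> ?c = 1 \<or> ?a = 0 \<and> ?b = 1 \<and> ?c = 1"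
      by blast
    \<comment> \<open>Each pattern survives in exactly one summand on the left, with factor 1,
      \<eta> or \<xi>; on the right the divisions leave the same factor of
      \<open>\<xi> * \<eta>\<close>.\<close>
    then show ?thesis
      using eval [of t 1 1 0] eval [of t 1 0 \<eta>] eval [of t 0 1 \<xi>] eval [of t "1 / \<xi>" "1 / \<eta>" 1] nz
      by (elim disjE conjE) simp_all
  qed
  then show ?thesis
    unfolding poly_eval_monom_eval sum_distrib_left sum.distrib [symmetric]
    by (intro sum.cong refl) (simp add: algebra_simps flip: distrib_left)
qed

subsection \<open>Moving the zero to a coordinate point\<close>

text \<open>The \<open>i\<close>-th coordinate of the vector obtained from \<open>x\<^sub>1, \<dots>, x\<^sub>m\<^sub>-\<^sub>1, 0\<close> by swapping the entries
  \<open>p\<close> and \<open>m\<close> and adding \<open>z c\<close>. This linear map from \<open>(x, z)\<close> is invertible when \<open>c\<^sub>p \<noteq> 0\<close>.\<close>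

definition zero_adapted :: "(nat \<Rightarrow> tvar) \<Rightarrow> (nat \<Rightarrow> real) \<Rightarrow> nat \<Rightarrow> nat \<Rightarrow> nat \<Rightarrow> rpoly" where
  "zero_adapted C c p m i =
     (if i = p then 0 else pvar (C (if i = m then p else i))) + pconst (c i) * pvar VZ"

text \<open>Entry \<open>p\<close> of the image is \<open>z * c p\<close>, which determines
  \<open>z\<close>; subtracting \<open>z * c i\<close> from the other entries and undoing the swap
  recovers the x-coordinates.\<close>

definition zero_adapted_inv :: "(nat \<Rightarrow> tvar) \<Rightarrow> (nat \<Rightarrow> real) \<Rightarrow> nat \<Rightarrow> nat \<Rightarrow> nat \<Rightarrow> rpoly" where
  "zero_adapted_inv C c p m j =
     (let i = if j = p then m else j in pvar (C i) - pconst (c i / c p) * pvar (C p))"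

text \<open>Keeping the products explicit lets degrees be read off factor by factor.\<close>

definition biquadratic_subst ::
    "nat \<Rightarrow> nat \<Rightarrow> (nat \<Rightarrow> nat \<Rightarrow> nat \<Rightarrow> nat \<Rightarrow> real) \<Rightarrow> (nat \<Rightarrow> rpoly) \<Rightarrow> (nat \<Rightarrow> rpoly) \<Rightarrow> rpoly" where
  "biquadratic_subst m n a X Y =
     (\<Sum>i=1..m. \<Sum>j=1..m. \<Sum>k=1..n. \<Sum>l=1..n. pconst (a i j k l) * X i * X j * Y k * Y l)"

lemma poly_eval_biquadratic_form:
  "poly_eval (biquadratic_form m n a) u =
    (\<Sum>i=1..m. \<Sum>j=1..m. \<Sum>k=1..n. \<Sum>l=1..n. a i j k l * u (VX i) * u (VX j) * u (VY k) * u (VY l))"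
  by (simp add: biquadratic_form_def)

text \<open>The value \<open>z\<close> is arbitrary because the biquadratic form does not involve
  \<open>VZ\<close>.\<close>

lemma poly_eval_biquadratic_subst:
  "poly_eval (biquadratic_subst m n a X Y) u = poly_eval (biquadratic_form m n a)
    (case_tvar (\<lambda>i. poly_eval (X i) u) (\<lambda>k. poly_eval (Y k) u) z)"
  by (simp add: biquadratic_subst_def poly_eval_biquadratic_form)

lemma poly_eval_biquadratic_form_scale:
  assumes "\<And>i. i \<in> {1..m} \<Longrightarrow> u (VX i) = \<xi> * w (VX i)"
    and "\<And>k. k \<in> {1..n} \<Longrightarrow> u (VY k) = \<eta> * w (VY k)"
  shows "poly_eval (biquadratic_form m n a) u = (\<xi> * \<eta>)\<^sup>2 * poly_eval (biquadratic_form m n a) w"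
  unfolding poly_eval_biquadratic_form sum_distrib_left
  by (intro sum.cong refl) (simp only: assms power2_eq_square mult_ac)

lemma is_form_zero_adapted:
  assumes "p \<in> {1..m}" "i \<in> {1..m}" "C ` {1..m - 1} \<subseteq> V" "VZ \<in> V"
  shows "is_form V 1 (zero_adapted C c p m i)"
proof -
  \<comment> \<open>The index \<open>m\<close> never occurs: for \<open>i = m\<close> it is replaced
    by \<open>p\<close>, and \<open>p = m\<close> falls under \<open>i = p\<close>.\<close>
  have "i = p \<or> (if i = m then p else i) \<in> {1..m - 1}"
    using assms(1,2) by auto
  then show ?thesis
    unfolding zero_adapted_def using assms(3,4)
    by (auto simp del: One_nat_def intro!: is_form_add is_form_scale is_form_var)
qed

lemma is_form_zero_adapted_inv:
  assumes "p \<in> {1..m}" "j \<in> {1..m}" "C ` {1..m} \<subseteq> V"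
  shows "is_form V 1 (zero_adapted_inv C c p m j)"
  unfolding zero_adapted_inv_def Let_def using assms
  by (auto simp del: One_nat_def intro!: is_form_diff is_form_scale is_form_var)

text \<open>Covers both uses at once: \<open>d = 1\<close> for the block of \<open>C\<close> and
  \<open>d = 0\<close> for the other block.\<close>

lemma deg_bounded_zero_adapted:
  assumes "VZ \<notin> S" "\<And>j. C j \<in> S \<Longrightarrow> 1 \<le> d"
  shows "deg_bounded S d (zero_adapted C c p m i)"
proof -
  have "deg_bounded S d (pvar (C j))" for j
    using deg_bounded_var [of S "C j"] assms(2) [of j]
    by (auto simp: deg_bounded_def split: if_splits)
  moreover have "deg_bounded S d (pconst (c i) * pvar VZ)"
    using deg_bounded_mult [OF deg_bounded_const deg_bounded_var [of S VZ]] assms(1)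
    by (fastforce simp: deg_bounded_def)
  ultimately show ?thesis
    unfolding zero_adapted_def by (auto intro: deg_bounded_add)
qed

text \<open>The inverse map sends \<open>w\<close> to a point with \<open>z = \<xi>\<close>; \<open>u\<close> is this point rescaled to \<open>z = 1\<close>.\<close>

lemma zero_adapted_inverse:
  assumes "c p \<noteq> 0" and \<xi>: "\<xi> = w (C p) / c p" "\<xi> \<noteq> 0"
    and u: "\<And>j. u (C j) = poly_eval (zero_adapted_inv C c p m j) w / \<xi>" "u VZ = 1"
  shows "w (C i) = \<xi> * poly_eval (zero_adapted C c p m i) u"
  using assms(1,3) unfolding zero_adapted_def zero_adapted_inv_def Let_def
  by (auto simp: u zero_adapted_inv_def \<xi>(1) field_simps)

lemma biquadratic_subst_tripartite:
  assumes "p \<in> {1..m}" "q \<in> {1..n}"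
  shows "tripartite_quartic (m - 1) (n - 1)
    (biquadratic_subst m n a (zero_adapted VX c p m) (zero_adapted VY d q n))"
proof -
  let ?X = "zero_adapted VX c p m"
  let ?Y = "zero_adapted VY d q n"
  let ?V = "tri_vars (m - 1) (n - 1)"
  let ?h = "biquadratic_subst m n a ?X ?Y"
  \<comment> \<open>The unsimplified sums, here and below, list the degrees of the five factors in
    order, as the product rules expect.\<close>
  have "is_form ?V (0 + 1 + 1 + 1 + 1) ?h"
    unfolding biquadratic_subst_def
    by (intro is_form_sum is_form_mult is_form_const is_form_zero_adapted)
      (use assms in \<open>auto simp: tri_vars_def\<close>)
  moreover have "deg_bounded (range VX) (0 + 1 + 1 + 0 + 0) ?h"
    unfolding biquadratic_subst_def
    by (intro deg_bounded_sum deg_bounded_mult deg_bounded_const deg_bounded_zero_adapted) auto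
  moreover have "deg_bounded (range VY) (0 + 0 + 0 + 1 + 1) ?h"
    unfolding biquadratic_subst_def
    by (intro deg_bounded_sum deg_bounded_mult deg_bounded_const deg_bounded_zero_adapted) auto
  ultimately show ?thesis
    by (auto simp: tripartite_quartic_def deg_bounded_def numeral_eq_Suc)
qed

lemma poly_eval_case_tvar:
  "(\<lambda>v. poly_eval (case_tvar X Y Z v) u) =
    case_tvar (\<lambda>i. poly_eval (X i) u) (\<lambda>k. poly_eval (Y k) u) (poly_eval Z u)"
  by (auto simp: fun_eq_iff split: tvar.split)

section \<open>Transfer of sums of squares between the two forms\<close>

lemma sum_of_squares_biquadratic_imp_subst:
  assumes p: "p \<in> {1..m}" and q: "q \<in> {1..n}"
    and sos: "sum_of_squares (bi_vars m n) r (biquadratic_form m n a)"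
  shows "sum_of_squares (tri_vars (m - 1) (n - 1)) r
    (biquadratic_subst m n a (zero_adapted VX c p m) (zero_adapted VY d q n))"
proof -
  let ?X = "zero_adapted VX c p m"
  let ?Y = "zero_adapted VY d q n"
  \<comment> \<open>\<open>VZ\<close> may be sent to 0, as it does not belong to
    \<open>bi_vars m n\<close>.\<close>
  let ?L = "case_tvar ?X ?Y 0"
  from sos obtain g where g: "\<forall>i<r. is_form (bi_vars m n) 2 (g i)"
    and f: "biquadratic_form m n a = (\<Sum>i<r. (g i)\<^sup>2)"
    by (auto simp: sum_of_squares_def)
  have "is_form (tri_vars (m - 1) (n - 1)) 1 (?L v)" if "v \<in> bi_vars m n" for v
    using that p q
    by (auto simp: bi_vars_def tri_vars_def intro!: is_form_zero_adapted simp del: One_nat_def)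
  then have "\<forall>i<r. is_form (tri_vars (m - 1) (n - 1)) 2 (poly_subst (g i) ?L)"
    using g is_form_subst by blast
  moreover have "biquadratic_subst m n a ?X ?Y = (\<Sum>i<r. (poly_subst (g i) ?L)\<^sup>2)"
    by (rule poly_eqI) (simp add: poly_eval_case_tvar poly_eval_biquadratic_subst [where z = 0] f)
  ultimately show ?thesis
    by (auto simp: sum_of_squares_def)
qed

lemma sum_of_squares_subst_imp_biquadratic:
  assumes p: "p \<in> {1..m}" "c p \<noteq> 0" and q: "q \<in> {1..n}" "d q \<noteq> 0"
    and h: "h = biquadratic_subst m n a (zero_adapted VX c p m) (zero_adapted VY d q n)"
    and degen: "degenerated_tripartite_quartic (m - 1) (n - 1) h"
    and sos: "sum_of_squares (tri_vars (m - 1) (n - 1)) r h"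
  shows "sum_of_squares (bi_vars m n) r (biquadratic_form m n a)"
proof -
  let ?V = "tri_vars (m - 1) (n - 1)"
  from sos obtain g where g: "\<forall>i<r. is_form ?V 2 (g i)" and hg: "h = (\<Sum>i<r. (g i)\<^sup>2)"
    by (auto simp: sum_of_squares_def)
  have deg: "degree_in UNIV t = 4" "degree_in (range VX) t \<le> 2" "degree_in (range VY) t \<le> 2"
    if "t \<in> Poly_Mapping.keys h" for t
    using degen that
    by (auto simp: degenerated_tripartite_quartic_def tripartite_quartic_def is_form_def)
  \<comment> \<open>Total degree 4 exceeds the bound 2 on each block.\<close>
  have no_X: "\<forall>t\<in>Poly_Mapping.keys h. \<not> Poly_Mapping.keys t \<subseteq> range VX" and no_Y: "\<forall>t\<in>Poly_Mapping.keys h. \<not> Poly_Mapping.keys t \<subseteq> range VY"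
    using deg degree_in_UNIV by fastforce+
  have no_Z: "\<forall>t\<in>Poly_Mapping.keys h. \<not> Poly_Mapping.keys t \<subseteq> {VZ}"
  proof (intro ballI notI)
    fix t
    assume t: "t \<in> Poly_Mapping.keys h" "Poly_Mapping.keys t \<subseteq> {VZ}"
    then have "degree_in {VZ} t = 4"
      using deg(1) degree_in_UNIV by metis
    then have "Poly_Mapping.lookup t VZ = 4"
      using degree_in_superset [of "{VZ}" t "{VZ}"] t(2) by simp
    then have "t = Poly_Mapping.single VZ 4"
      using t(2) by (intro poly_mapping_eqI) (auto simp: lookup_single when_def in_keys_iff)
    then show False
      using t(1) degen by (simp add: degenerated_tripartite_quartic_def in_keys_iff)
  qed
  let ?X = "zero_adapted_inv VX c p m"
  let ?Y = "zero_adapted_inv VY d q n"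
  let ?\<xi> = "pconst (1 / c p) * pvar (VX p)"
  let ?\<eta> = "pconst (1 / d q) * pvar (VY q)"
  \<comment> \<open>The bihomogenised forms in the original variables: \<eta> and \<xi> are the
    coordinates along the zero, in the roles of \<open>y\<^sub>n\<close> and
    \<open>x\<^sub>m\<close>.\<close>
  let ?G = "\<lambda>i. poly_subst (g i) (case_tvar ?X ?Y 0) +
    poly_subst (g i) (case_tvar ?X (\<lambda>_. 0) ?\<eta>) + poly_subst (g i) (case_tvar (\<lambda>_. 0) ?Y ?\<xi>)"
  have X: "is_form (bi_vars m n) 1 (?X j)" if "j \<in> {1..m - 1}" for j
    using that p by (intro is_form_zero_adapted_inv) (auto simp: bi_vars_def)
  have Y: "is_form (bi_vars m n) 1 (?Y j)" if "j \<in> {1..n - 1}" for j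
    using that q by (intro is_form_zero_adapted_inv) (auto simp: bi_vars_def)
  have "is_form (bi_vars m n) 1 ?\<xi>" "is_form (bi_vars m n) 1 ?\<eta>"
    using p q by (auto simp: bi_vars_def simp del: One_nat_def intro!: is_form_scale is_form_var)
  with X Y have "is_form (bi_vars m n) 2 (?G i)" if "i < r" for i
    using g that
    by (intro is_form_add is_form_subst [where W = ?V])
      (auto simp: tri_vars_def simp del: One_nat_def)
  moreover have "biquadratic_form m n a = (\<Sum>i<r. (?G i)\<^sup>2)"
  proof (rule poly_eqI)
    fix w :: "tvar \<Rightarrow> real"
    assume w: "\<forall>v. w v \<noteq> 0"
    define \<xi> \<eta> where \<xi>: "\<xi> = w (VX p) / c p" and \<eta>: "\<eta> = w (VY q) / d q"
    \<comment> \<open>The inverse maps give two generally different values \<xi> and \<eta> for the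
      single variable \<open>VZ\<close>; rescaling the blocks separately turns both into 1.\<close>
    define u where "u = case_tvar (\<lambda>i. poly_eval (?X i) w / \<xi>) (\<lambda>k. poly_eval (?Y k) w / \<eta>) 1"
    have nz: "\<xi> \<noteq> 0" "\<eta> \<noteq> 0"
      using w p q by (auto simp: \<xi> \<eta>)
    have eval_G: "poly_eval (?G i) w = \<xi> * \<eta> * poly_eval (g i) u" if "i < r" for i
      using poly_eval_bihomogenize [OF _ _ _ _ nz, of ?V "g i"] g that
        sum_of_squares_keys [where r = r and q = g, folded hg, OF no_X that]
        sum_of_squares_keys [where r = r and q = g, folded hg, OF no_Y that]
        sum_of_squares_keys [where r = r and q = g, folded hg, OF no_Z that]
      by (simp add: poly_eval_case_tvar u_def \<xi> \<eta>)
    \<comment> \<open>Bidegree (2,2) produces the square of the factor found in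
      \<open>eval_G\<close>.\<close>
    have "poly_eval (biquadratic_form m n a) w = (\<xi> * \<eta>)\<^sup>2 * poly_eval h u"
      unfolding h poly_eval_biquadratic_subst [where z = 0]
    proof (rule poly_eval_biquadratic_form_scale)
      show "w (VX i) = \<xi> * case_tvar (\<lambda>i. poly_eval (zero_adapted VX c p m i) u)
          (\<lambda>k. poly_eval (zero_adapted VY d q n k) u) 0 (VX i)" for i
        using zero_adapted_inverse [where C = VX and c = c and p = p and w = w and u = u, OF p(2) \<xi> nz(1)] by (simp add: u_def)
      show "w (VY k) = \<eta> * case_tvar (\<lambda>i. poly_eval (zero_adapted VX c p m i) u)
          (\<lambda>k. poly_eval (zero_adapted VY d q n k) u) 0 (VY k)" for k
        using zero_adapted_inverse [where C = VY and c = d and p = q and w = w and u = u, OF q(2) \<eta> nz(2)] by (simp add: u_def)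
    qed
    also have "\<dots> = (\<Sum>i<r. (\<xi> * \<eta> * poly_eval (g i) u)\<^sup>2)"
      by (simp add: hg sum_distrib_left power_mult_distrib)
    also have "\<dots> = poly_eval (\<Sum>i<r. (?G i)\<^sup>2) w"
      unfolding poly_eval_sum poly_eval_power by (intro sum.cong refl) (simp only: eval_G lessThan_iff)
    finally show "poly_eval (biquadratic_form m n a) w = poly_eval (\<Sum>i<r. (?G i)\<^sup>2) w" .
  qed
  ultimately show ?thesis
    unfolding sum_of_squares_def by (intro exI [of _ ?G] conjI allI impI)
qed

text \<open>All values of the new form are values of the old one, and the z-axis is mapped to
  multiples of the zero, so no monomial in \<open>VZ\<close> alone occurs.\<close>

lemma biquadratic_subst_degenerated:
  assumes p: "p \<in> {1..m}" and q: "q \<in> {1..n}"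
    and psd: "psd (biquadratic_form m n a)"
    and zero: "poly_eval (biquadratic_form m n a) (point c d 0) = 0"
  shows "degenerated_tripartite_quartic (m - 1) (n - 1)
    (biquadratic_subst m n a (zero_adapted VX c p m) (zero_adapted VY d q n))"
    (is "degenerated_tripartite_quartic _ _ ?h")
proof -
  have "poly_eval ?h u \<ge> 0" for u
    using psd unfolding psd_def poly_eval_biquadratic_subst [where z = 0] by blast
  moreover have "poly_eval ?h (\<lambda>v. if v \<in> {VZ} then u v else 0) = 0" for u
  proof -
    let ?u = "\<lambda>v. if v \<in> {VZ} then u v else 0"
    have "poly_eval ?h ?u = (u VZ * u VZ)\<^sup>2 * poly_eval (biquadratic_form m n a) (point c d 0)"
      unfolding poly_eval_biquadratic_subst [where z = 0]
      by (rule poly_eval_biquadratic_form_scale) (auto simp: point_def zero_adapted_def)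
    then show ?thesis
      using zero by simp
  qed
  then have "\<forall>t\<in>Poly_Mapping.keys ?h. \<not> Poly_Mapping.keys t \<subseteq> {VZ}"
    by (simp only: poly_eval_restrict_eq_0_iff [symmetric]) simp
  then have "Poly_Mapping.single VZ 4 \<notin> Poly_Mapping.keys ?h"
    by auto
  ultimately show ?thesis
    using biquadratic_subst_tripartite [OF p q]
    by (auto simp: degenerated_tripartite_quartic_def psd_def in_keys_iff)
qed

theorem theorem2p2:
  fixes m n :: nat
    and a :: "nat \<Rightarrow> nat \<Rightarrow> nat \<Rightarrow> nat \<Rightarrow> real"
    and f :: rpoly
  assumes "m \<ge> 2" and "n \<ge> 2"
    and "f = biquadratic_form m n a"
    and "psd f"
    and "\<exists>x y :: nat \<Rightarrow> real. (\<exists>i\<in>{1..m}. x i \<noteq> 0) \<and> (\<exists>k\<in>{1..n}. y k \<noteq> 0) \<and>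
           poly_eval f (point x y 0) = 0"
  shows "\<exists>h :: rpoly. degenerated_tripartite_quartic (m - 1) (n - 1) h \<and>
           (is_sos (bi_vars m n) f \<longleftrightarrow> is_sos (tri_vars (m - 1) (n - 1)) h) \<and>
           (is_sos (bi_vars m n) f \<longrightarrow>
              sos_rank (bi_vars m n) f = sos_rank (tri_vars (m - 1) (n - 1)) h)"
proof -
  from assms(5) obtain c d p q where p: "p \<in> {1..m}" "c p \<noteq> 0" and q: "q \<in> {1..n}" "d q \<noteq> 0"
    and zero: "poly_eval f (point c d 0) = 0"
    by blast
  define h where "h = biquadratic_subst m n a (zero_adapted VX c p m) (zero_adapted VY d q n)"
  have degen: "degenerated_tripartite_quartic (m - 1) (n - 1) h"
    using biquadratic_subst_degenerated [OF p(1) q(1)] assms(3,4) zero by (simp add: h_def)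
  \<comment> \<open>Equality for every \<open>r\<close> gives both the equivalence of
    \<open>is_sos\<close> and equal least \<open>r\<close>.\<close>
  have "sum_of_squares (bi_vars m n) r f = sum_of_squares (tri_vars (m - 1) (n - 1)) r h" for r
    using sum_of_squares_biquadratic_imp_subst [OF p(1) q(1)]
      sum_of_squares_subst_imp_biquadratic [OF p q h_def degen] assms(3)
    by (auto simp: h_def)
  then show ?thesis
    using degen by (auto simp: is_sos_def sos_rank_def)
qed

end
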